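(* Let $\delta > 0$ and let $V = \{v_1,\ldots,v_n\} \subset \mathbb{C}^d$ be a $\delta$-SG configuration of $n$ points. Then $$\operatorname{affine-dim}(v_1,\ldots,v_n) \leq 12/\delta.$$ Moreover, when $\delta = 1$, one has $\operatorname{affine-dim}(v_1,\ldots,v_n) \leq 2$.
   Context: Points are distinct. Given a finite set of points $v_1,\dots,v_n \in \mathbb{C}^d$, a (complex) line is called special if it passes through at least three of the points of the set. The set is a $\delta$-SG configuration if for every $i \in [n]$, at least $\delta(n-1)$ of the remaining points lie on special lines through $v_i$. $\operatorname{affine-dim}(v_1,\dots,v_n)$ is the (complex) dimension of the affine span of $v_1,\dots,v_n$, i.e. the minimum $r$ such that the points are contained in a shift of a linear subspace of dimension $r$. *)

theory Defs
  imports "HOL-Analysis.Analysis"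
begin

text \<open>All linear algebra here is over the complex numbers: the library's \<open>affine hull\<close>,
  \<open>collinear\<close>, \<open>dim\<close> and \<open>aff_dim\<close> are the real notions, whereas \<open>*s\<close>, \<open>vec.subspace\<close> and
  \<open>vec.dim\<close> are taken over the coordinate field.\<close>

definition complex_line :: "(complex ^ 'd) set \<Rightarrow> bool" where
  "complex_line L \<longleftrightarrow> (\<exists>a u. u \<noteq> 0 \<and> L = {a + t *s u | t. True})"

definition special_line :: "(complex ^ 'd) set \<Rightarrow> (complex ^ 'd) set \<Rightarrow> bool" where
  "special_line V L \<longleftrightarrow> complex_line L \<and> card (L \<inter> V) \<ge> 3"

text \<open>The right-hand side \<open>\<delta> (n - 1)\<close> is computed in the reals, with \<open>n = card V\<close>.\<close>

definition SG_configuration :: "real \<Rightarrow> (complex ^ 'd) set \<Rightarrow> bool" where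
  "SG_configuration \<delta> V \<longleftrightarrow> finite V \<and>
     (\<forall>v\<in>V. real (card {w \<in> V - {v}. \<exists>L. special_line V L \<and> v \<in> L \<and> w \<in> L})
              \<ge> \<delta> * (real (card V) - 1))"

definition complex_affine_dim :: "(complex ^ 'd) set \<Rightarrow> nat" where
  "complex_affine_dim V =
     (LEAST r. \<exists>a W. vec.subspace W \<and> vec.dim W = r \<and> V \<subseteq> (\<lambda>x. a + x) ` W)"

end

theory Submission
  imports Defs
begin

text \<open>
  Put the points into homogeneous coordinates and let \<open>D\<close> be the dimension of their span. A linear map
  \<open>T\<close> of determinant 1 minimizing \<open>\<Sum>x. norm (T x) powr p\<close> is in isotropic position: with weights
  \<open>c x\<close> proportional to \<open>norm (T x) powr p\<close> and \<open>g x y\<close> the squared cosine of the angle between \<open>T x\<close>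
  and \<open>T y\<close>, every row sum \<open>\<Sum>y. c y * g x y\<close> equals 1, so the sum of \<open>c y * g x y\<close> over \<open>x \<noteq> y\<close> is
  at most \<open>n - \<Sum>x. c x\<close>, where \<open>\<Sum>x. c x \<ge> D\<close>. Conversely three vectors in a plane have squared cosines
  summing to at least \<open>3 / 4\<close>. If the weights of three collinear points are very unequal and \<open>p\<close> is
  small, then the shortest of the three images is negligible and the other two are almost parallel, so in
  every case the triple contributes nearly as much as for equal weights. Averaging over collinear
  triples and letting \<open>p\<close> tend to 0 yields \<open>D * (4 + \<delta> * (n - 1)) \<le> 4 * n\<close>, which contains both claims.
\<close>

subsection \<open>Isotropic position\<close>

lemma norm_vec_power2: "(norm (x :: complex ^ 'n))\<^sup>2 = (\<Sum>i\<in>UNIV. (norm (x $ i))\<^sup>2)"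
  by (simp add: norm_vec_def L2_set_def sum_nonneg)

lemma norm_vec_smult: "norm (c *s (x :: complex ^ 'n)) = norm c * norm x"
  by (simp add: norm_vec_def L2_set_def norm_mult power_mult_distrib
      flip: sum_distrib_left) (simp add: real_sqrt_mult)

lemma norm_matrix_le_sum_entries:
  fixes S :: "complex ^ 'n ^ 'm"
  shows "norm S \<le> (\<Sum>i\<in>UNIV. \<Sum>j\<in>UNIV. norm (S $ i $ j))"
proof -
  have "norm S \<le> (\<Sum>i\<in>UNIV. norm (S $ i))"
    unfolding norm_vec_def by (rule L2_set_le_sum) simp
  also have "\<dots> \<le> (\<Sum>i\<in>UNIV. \<Sum>j\<in>UNIV. norm (S $ i $ j))"
    by (rule sum_mono, subst norm_vec_def, rule L2_set_le_sum) simp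
  finally show ?thesis .
qed

lemma continuous_on_matrix_vector_mult:
  "continuous_on A (\<lambda>S :: complex ^ 'n ^ 'm. S *v x)"
  unfolding matrix_vector_mult_def by (intro continuous_intros)

lemma continuous_on_det: "continuous_on A (\<lambda>S :: complex ^ 'n ^ 'n. det S)"
  unfolding det_def by (intro continuous_intros)

text \<open>Compactness: since \<open>X\<close> spans, bounds on all \<open>S *v x\<close> bound
  \<open>S\<close> itself, so a sublevel set of the continuous objective inside the closed set
  \<open>det S = 1\<close> is compact.\<close>

lemma det_one_minimizer:
  fixes X :: "(complex ^ 'n) set"
  assumes "finite X" and span: "vec.span X = UNIV" and "p > 0"
  obtains T :: "complex ^ 'n ^ 'n" where "det T = 1"
    and "\<And>S :: complex ^ 'n ^ 'n. det S = 1 \<Longrightarrow>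
      (\<Sum>x\<in>X. norm (T *v x) powr p) \<le> (\<Sum>x\<in>X. norm (S *v x) powr p)"
proof -
  define F where "F S = (\<Sum>x\<in>X. norm (S *v x) powr p)" for S :: "complex ^ 'n ^ 'n"
  \<comment> \<open>The condition \<open>det S = 1\<close> alone need not cut out a bounded set;
    comparison with \<open>mat 1\<close> does, and keeps \<open>mat 1\<close> as a member.\<close>
  define K where "K = {S. det S = 1} \<inter> {S. F S \<le> F (mat 1)}"
  have contF: "continuous_on A F" for A
    unfolding F_def using \<open>p > 0\<close>
    by (intro continuous_on_sum continuous_on_powr' continuous_on_norm
        continuous_on_matrix_vector_mult continuous_on_const) auto
  have "closed K"
    unfolding K_def
    using closed_Collect_eq[OF continuous_on_det continuous_on_const]
      closed_Collect_le[OF contF continuous_on_const] by (rule closed_Int)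
  define R where "R = F (mat 1) powr (1 / p)"
  have bound: "norm (S *v x) \<le> R" if "S \<in> K" "x \<in> X" for S x
  proof -
    have "norm (S *v x) powr p \<le> F S"
      unfolding F_def using \<open>finite X\<close> \<open>x \<in> X\<close> by (intro member_le_sum) auto
    also have "\<dots> \<le> F (mat 1)" using \<open>S \<in> K\<close> by (simp add: K_def)
    finally have "(norm (S *v x) powr p) powr (1 / p) \<le> R"
      unfolding R_def using \<open>p > 0\<close> by (intro powr_mono2) auto
    then show ?thesis using \<open>p > 0\<close> by (simp add: powr_powr)
  qed
  \<comment> \<open>Expanding each basis vector in \<open>X\<close> turns bounds on the images of
    \<open>X\<close> into bounds on the columns of \<open>S\<close>.\<close>
  have "\<exists>u. axis j 1 = (\<Sum>x\<in>X. u x *s x)" for j :: 'n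
  proof -
    have "axis j 1 \<in> range (\<lambda>u. \<Sum>x\<in>X. u x *s x)"
      unfolding vec.span_finite[OF \<open>finite X\<close>, symmetric] span by simp
    then show ?thesis by blast
  qed
  then obtain u where u: "\<And>j :: 'n. axis j 1 = (\<Sum>x\<in>X. u j x *s x)"
    using choice[of "\<lambda>j u. axis j 1 = (\<Sum>x\<in>X. u x *s x)"] by blast
  have "norm (S $ i $ j) \<le> (\<Sum>x\<in>X. norm (u j x) * R)" if "S \<in> K" for S i j
  proof -
    have "S $ i $ j = (S *v axis j 1) $ i"
      by (simp add: matrix_vector_mult_def axis_def if_distrib[of "\<lambda>c. _ * c"] cong: if_cong)
    then have "norm (S $ i $ j) \<le> norm (S *v axis j 1)"
      by (simp add: Finite_Cartesian_Product.norm_nth_le)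
    also have "S *v axis j 1 = (\<Sum>x\<in>X. u j x *s (S *v x))"
      unfolding u by (simp add: vec.linear_sum[OF matrix_vector_mul_linear_gen] vector_scalar_commute)
    also have "norm \<dots> \<le> (\<Sum>x\<in>X. norm (u j x) * R)"
      by (rule sum_norm_le) (auto simp: norm_vec_smult intro!: mult_left_mono bound that)
    finally show ?thesis .
  qed
  then have "norm S \<le> (\<Sum>i\<in>(UNIV::'n set). \<Sum>j\<in>UNIV. \<Sum>x\<in>X. norm (u j x) * R)" if "S \<in> K" for S
    using that by (intro order.trans[OF norm_matrix_le_sum_entries] sum_mono) auto
  then have "bounded K" by (auto simp: bounded_iff)
  with \<open>closed K\<close> have "compact K" by (simp add: compact_eq_bounded_closed)
  moreover have "mat 1 \<in> K" by (simp add: K_def det_I)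
  ultimately obtain T where T: "T \<in> K" "\<And>S. S \<in> K \<Longrightarrow> F T \<le> F S"
    using continuous_attains_inf[OF _ _ contF] by (metis empty_iff)
  have "F T \<le> F S" if "det S = 1" for S
  proof (cases "F S \<le> F (mat 1)")
    case True
    with that show ?thesis by (intro T(2)) (simp add: K_def)
  next
    case False
    moreover have "F T \<le> F (mat 1)" using T(1) by (simp add: K_def)
    ultimately show ?thesis by simp
  qed
  with T(1) show thesis by (intro that) (auto simp: K_def F_def)
qed

section \<open>First-order conditions at the minimizer\<close>

lemma sum_powr_stationary:
  fixes q :: "'a \<Rightarrow> real \<Rightarrow> real"
  assumes "finite X" and "e \<noteq> 0"
    and der: "\<And>x. x \<in> X \<Longrightarrow> (q x has_real_derivative d x) (at 0)"
    and pos: "\<And>x. x \<in> X \<Longrightarrow> q x 0 > 0"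
    and min: "\<And>s. (\<Sum>x\<in>X. q x 0 powr e) \<le> (\<Sum>x\<in>X. q x s powr e)"
  shows "(\<Sum>x\<in>X. q x 0 powr (e - 1) * d x) = 0"
proof -
  \<comment> \<open>Positivity of \<open>q x 0\<close> makes the real power differentiable at
    \<open>s = 0\<close>.\<close>
  have "((\<lambda>s. \<Sum>x\<in>X. q x s powr e) has_real_derivative (\<Sum>x\<in>X. e * q x 0 powr (e - 1) * d x)) (at 0)"
    by (rule DERIV_sum) (use DERIV_fun_powr[OF der pos] in auto)
  then have "(\<Sum>x\<in>X. e * q x 0 powr (e - 1) * d x) = 0"
    by (rule DERIV_local_min[where d = 1]) (auto intro: min)
  then show ?thesis
    using \<open>e \<noteq> 0\<close> by (simp add: mult.assoc flip: sum_distrib_left)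
qed

definition herm_inner :: "complex ^ 'n \<Rightarrow> complex ^ 'n \<Rightarrow> complex" where
  "herm_inner x y = (\<Sum>i\<in>UNIV. x $ i * cnj (y $ i))"

lemma cnj_herm_inner: "cnj (herm_inner x y) = herm_inner y x"
  by (simp add: herm_inner_def mult.commute)

lemma herm_inner_self: "herm_inner x x = of_real ((norm x)\<^sup>2)"
  unfolding herm_inner_def norm_vec_power2 of_real_sum by (intro sum.cong refl complex_norm_square[symmetric])

lemma herm_inner_add_left: "herm_inner (x + y) z = herm_inner x z + herm_inner y z"
  by (simp add: herm_inner_def algebra_simps sum.distrib)

lemma herm_inner_smult_left: "herm_inner (c *s x) z = c * herm_inner x z"
  by (simp add: herm_inner_def algebra_simps sum_distrib_left)

lemma herm_inner_add_right: "herm_inner z (x + y) = herm_inner z x + herm_inner z y"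
  by (simp add: herm_inner_def algebra_simps sum.distrib)

lemma herm_inner_smult_right: "herm_inner z (c *s x) = cnj c * herm_inner z x"
  by (simp add: herm_inner_def algebra_simps sum_distrib_left)

lemma norm_herm_inner_commute: "norm (herm_inner x y) = norm (herm_inner y x)"
  by (metis cnj_herm_inner complex_mod_cnj)

text \<open>The shear adding \<open>s * z\<close> times coordinate \<open>b\<close> to coordinate
  \<open>a\<close> has determinant 1, so the objective is stationary along it. With \<open>z\<close>
  arbitrary this kills the off-diagonal entries of a weighted second-moment matrix.\<close>

lemma shear_stationary:
  fixes T :: "complex ^ 'n ^ 'n"
  assumes "finite X" "p > 0" "det T = 1" "a \<noteq> b"
    and nz: "\<And>x. x \<in> X \<Longrightarrow> T *v x \<noteq> 0"
    and min: "\<And>S :: complex ^ 'n ^ 'n. det S = 1 \<Longrightarrow>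
      (\<Sum>x\<in>X. norm (T *v x) powr p) \<le> (\<Sum>x\<in>X. norm (S *v x) powr p)"
  shows "(\<Sum>x\<in>X. norm (T *v x) powr (p - 2) * Re (z * ((T *v x) $ b * cnj ((T *v x) $ a)))) = 0"
proof -
  define E :: "real \<Rightarrow> complex ^ 'n ^ 'n" where "E s = (\<chi> k. if k = a then row a (mat 1) + (of_real s * z) *s row b (mat 1) else row k (mat 1))" for s
  have detE: "det (E s ** T) = 1" for s
    using det_row_operation[OF \<open>a \<noteq> b\<close>, of "mat 1" "of_real s * z"] \<open>det T = 1\<close>
    by (simp add: E_def det_mul det_I)
  have E: "(E s *v w) $ k = (if k = a then w $ a + of_real s * z * w $ b else w $ k)" for s w k
    by (simp add: E_def matrix_vector_mult_def row_def mat_def algebra_simps sum.distrib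
        if_distrib[of "\<lambda>c. c * _"] if_distrib[of "\<lambda>c. _ * c"] flip: sum_distrib_left cong: if_cong)
  \<comment> \<open>Squared norms are polynomial in \<open>s\<close>, hence the exponent
    \<open>p / 2\<close> in place of \<open>p\<close> below.\<close>
  define q where "q x s = (norm (E s *v (T *v x)))\<^sup>2" for x s
  have q: "q x s = (norm (T *v x))\<^sup>2 +
      2 * s * Re (z * ((T *v x) $ b * cnj ((T *v x) $ a))) + s\<^sup>2 * (norm (z * (T *v x) $ b))\<^sup>2" for x s
  proof -
    let ?w = "T *v x"
    have "q x s = (norm (?w $ a + of_real s * z * ?w $ b))\<^sup>2 + (\<Sum>k\<in>UNIV - {a}. (norm (?w $ k))\<^sup>2)"
      unfolding q_def norm_vec_power2 by (subst sum.remove[of _ a]) (auto simp: E)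
    moreover have "(norm ?w)\<^sup>2 = (norm (?w $ a))\<^sup>2 + (\<Sum>k\<in>UNIV - {a}. (norm (?w $ k))\<^sup>2)"
      unfolding norm_vec_power2 by (subst sum.remove[of _ a]) auto
    moreover have "(norm (?w $ a + of_real s * z * ?w $ b))\<^sup>2 = (norm (?w $ a))\<^sup>2 +
        2 * s * Re (z * (?w $ b * cnj (?w $ a))) + s\<^sup>2 * (norm (z * ?w $ b))\<^sup>2"
      unfolding cmod_power2 by (simp add: algebra_simps power2_eq_square)
    ultimately show ?thesis by simp
  qed
  have powr_q: "norm (E s *v (T *v x)) powr p = q x s powr (p / 2)" for x s
    unfolding q_def by (simp add: powr_powr flip: powr_numeral)
  have q0: "norm (T *v x) powr p = q x 0 powr (p / 2)" for x
    unfolding q by (simp add: powr_powr flip: powr_numeral)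
  have "(\<Sum>x\<in>X. q x 0 powr (p / 2 - 1) * (2 * Re (z * ((T *v x) $ b * cnj ((T *v x) $ a))))) = 0"
  proof (rule sum_powr_stationary)
    show "(q x has_real_derivative 2 * Re (z * ((T *v x) $ b * cnj ((T *v x) $ a)))) (at 0)" for x
      unfolding q by (auto intro!: derivative_eq_intros)
    show "q x 0 > 0" if "x \<in> X" for x using nz[OF that] by (simp add: q)
    show "(\<Sum>x\<in>X. q x 0 powr (p / 2)) \<le> (\<Sum>x\<in>X. q x s powr (p / 2))" for s
      using min[OF detE[of s]] by (simp add: powr_q flip: q0 matrix_vector_mul_assoc)
  qed (use assms in auto)
  moreover have "q x 0 powr (p / 2 - 1) = norm (T *v x) powr (p - 2)" for x
    unfolding q by (simp add: powr_powr algebra_simps flip: powr_numeral)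
  ultimately have "2 * (\<Sum>x\<in>X. norm (T *v x) powr (p - 2) * Re (z * ((T *v x) $ b * cnj ((T *v x) $ a)))) = 0"
    unfolding sum_distrib_left by (simp only: mult.left_commute)
  then show ?thesis by simp
qed

lemma sum_UNIV_remove2:
  fixes f :: "'n :: finite \<Rightarrow> real"
  assumes "a \<noteq> b"
  shows "sum f UNIV = f a + (f b + sum f (UNIV - {a} - {b}))"
  using assms by (simp add: sum.remove[of UNIV a f] sum.remove[of "UNIV - {a}" b f])

text \<open>Stretching coordinate \<open>a\<close> by \<open>exp s\<close> and shrinking
  \<open>b\<close> by the same factor keeps the determinant; stationarity equates two diagonal
  entries of the second-moment matrix.\<close>

lemma diagonal_stationary:
  fixes T :: "complex ^ 'n ^ 'n"
  assumes "finite X" "p > 0" "det T = 1" "a \<noteq> b"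
    and nz: "\<And>x. x \<in> X \<Longrightarrow> T *v x \<noteq> 0"
    and min: "\<And>S :: complex ^ 'n ^ 'n. det S = 1 \<Longrightarrow>
      (\<Sum>x\<in>X. norm (T *v x) powr p) \<le> (\<Sum>x\<in>X. norm (S *v x) powr p)"
  shows "(\<Sum>x\<in>X. norm (T *v x) powr (p - 2) * (norm ((T *v x) $ a))\<^sup>2) =
    (\<Sum>x\<in>X. norm (T *v x) powr (p - 2) * (norm ((T *v x) $ b))\<^sup>2)"
proof -
  define e where "e s k = (if k = a then exp s else if k = b then exp (- s) else 1)" for s :: real and k
  define E :: "real \<Rightarrow> complex ^ 'n ^ 'n"
    where "E s = (\<chi> i j. if i = j then of_real (e s i) else 0)" for s
  have "det (E s) = 1" for s
  proof -
    have "det (E s) = (\<Prod>i\<in>UNIV. of_real (e s i))"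
      by (subst det_diagonal) (auto simp: E_def)
    also have "\<dots> = of_real (e s a) * (of_real (e s b) * (\<Prod>i\<in>UNIV - {a} - {b}. of_real (e s i)))"
      using \<open>a \<noteq> b\<close> by (simp add: prod.remove[of _ a] prod.remove[of _ b])
    also have "(\<Prod>i\<in>UNIV - {a} - {b}. of_real (e s i)) = (1 :: complex)"
      by (rule prod.neutral) (auto simp: e_def)
    also have "of_real (e s a) * (of_real (e s b) * 1) = (1 :: complex)"
      using \<open>a \<noteq> b\<close> by (simp add: e_def exp_minus flip: of_real_mult)
    finally show ?thesis .
  qed
  then have detE: "det (E s ** T) = 1" for s
    using \<open>det T = 1\<close> by (simp add: det_mul)
  have E: "(E s *v w) $ k = of_real (e s k) * w $ k" for s w k
    by (simp add: E_def matrix_vector_mult_def if_distrib[of "\<lambda>c. c * _"] cong: if_cong)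
  define q where "q x s = (norm (E s *v (T *v x)))\<^sup>2" for x s
  have q: "q x s = (norm (T *v x))\<^sup>2 + ((exp s)\<^sup>2 - 1) * (norm ((T *v x) $ a))\<^sup>2
      + ((exp (- s))\<^sup>2 - 1) * (norm ((T *v x) $ b))\<^sup>2" for x s
  proof -
    let ?w = "T *v x"
    let ?R = "\<Sum>k\<in>UNIV - {a} - {b}. (norm (?w $ k))\<^sup>2"
    have "q x s = (exp s)\<^sup>2 * (norm (?w $ a))\<^sup>2 + ((exp (- s))\<^sup>2 * (norm (?w $ b))\<^sup>2 + ?R)"
    proof -
      have "(\<Sum>k\<in>UNIV - {a} - {b}. (norm ((E s *v ?w) $ k))\<^sup>2) = ?R"
        by (rule sum.cong) (auto simp: E e_def)
      then show ?thesis
        unfolding q_def norm_vec_power2 using \<open>a \<noteq> b\<close>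
        by (subst sum_UNIV_remove2[OF \<open>a \<noteq> b\<close>]) (simp add: E e_def norm_mult power_mult_distrib)
    qed
    moreover have "(norm ?w)\<^sup>2 = (norm (?w $ a))\<^sup>2 + ((norm (?w $ b))\<^sup>2 + ?R)"
      unfolding norm_vec_power2 by (rule sum_UNIV_remove2[OF \<open>a \<noteq> b\<close>])
    ultimately show ?thesis by (simp add: algebra_simps)
  qed
  have powr_q: "norm (E s *v (T *v x)) powr p = q x s powr (p / 2)" for x s
    unfolding q_def by (simp add: powr_powr flip: powr_numeral)
  have q0: "norm (T *v x) powr p = q x 0 powr (p / 2)" for x
    unfolding q by (simp add: powr_powr flip: powr_numeral)
  have "(\<Sum>x\<in>X. q x 0 powr (p / 2 - 1) * (2 * (norm ((T *v x) $ a))\<^sup>2 - 2 * (norm ((T *v x) $ b))\<^sup>2)) = 0"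
  proof (rule sum_powr_stationary)
    show "(q x has_real_derivative 2 * (norm ((T *v x) $ a))\<^sup>2 - 2 * (norm ((T *v x) $ b))\<^sup>2) (at 0)" for x
      unfolding q by (auto intro!: derivative_eq_intros)
    show "q x 0 > 0" if "x \<in> X" for x using nz[OF that] by (simp add: q)
    show "(\<Sum>x\<in>X. q x 0 powr (p / 2)) \<le> (\<Sum>x\<in>X. q x s powr (p / 2))" for s
      using min[OF detE[of s]] by (simp add: powr_q flip: q0 matrix_vector_mul_assoc)
  qed (use assms in auto)
  moreover have "q x 0 powr (p / 2 - 1) = norm (T *v x) powr (p - 2)" for x
    unfolding q by (simp add: powr_powr algebra_simps flip: powr_numeral)
  ultimately have "2 * (\<Sum>x\<in>X. norm (T *v x) powr (p - 2) *
      ((norm ((T *v x) $ a))\<^sup>2 - (norm ((T *v x) $ b))\<^sup>2)) = 0"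
    unfolding sum_distrib_left by (simp only: mult.left_commute right_diff_distrib)
  then show ?thesis by (simp add: right_diff_distrib sum_subtractf)
qed

text \<open>By the two stationarity conditions the second-moment matrix \<open>H\<close> of the
  weighted images is \<open>l\<close> times the identity; the stated equation is its quadratic form
  at \<open>u\<close>.\<close>

lemma isotropic_position:
  fixes X :: "(complex ^ 'n) set"
  assumes "finite X" "vec.span X = UNIV" "0 \<notin> X" "p > 0"
  obtains T :: "complex ^ 'n ^ 'n" and l where "invertible T"
    and "\<And>u. (\<Sum>x\<in>X. norm (T *v x) powr (p - 2) * (norm (herm_inner (T *v x) u))\<^sup>2) = l * (norm u)\<^sup>2"
proof -
  obtain T :: "complex ^ 'n ^ 'n" where det: "det T = 1" and
    min: "\<And>S :: complex ^ 'n ^ 'n. det S = 1 \<Longrightarrow>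
      (\<Sum>x\<in>X. norm (T *v x) powr p) \<le> (\<Sum>x\<in>X. norm (S *v x) powr p)"
    using det_one_minimizer[OF assms(1,2,4)] by blast
  have inv: "invertible T" using det by (simp add: invertible_det_nz)
  have nz: "T *v x \<noteq> 0" if "x \<in> X" for x
    using inv that \<open>0 \<notin> X\<close> by (metis inj_matrix_vector_mult injD matrix_vector_mult_0_right)
  define m where "m x = norm (T *v x) powr (p - 2)" for x
  define H where "H a b = (\<Sum>x\<in>X. of_real (m x) * ((T *v x) $ a * cnj ((T *v x) $ b)))" for a b
  have off: "H b a = 0" if "a \<noteq> b" for a b
  proof -
    have "Re (z * H b a) = 0" for z
    proof -
      have "z * H b a = (\<Sum>x\<in>X. of_real (m x) * (z * ((T *v x) $ b * cnj ((T *v x) $ a))))"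
        by (simp add: H_def sum_distrib_left mult.left_commute)
      moreover have "Re (of_real r * c) = r * Re c" for r c by simp
      ultimately show ?thesis
        using shear_stationary[OF \<open>finite X\<close> \<open>p > 0\<close> det that nz min, where z = z]
        by (simp only: Re_sum m_def)
    qed
    \<comment> \<open>The two values of \<open>z\<close> test the real and the imaginary
      part.\<close>
    from this[of 1] this[of \<i>] show ?thesis by (simp add: complex_eq_iff)
  qed
  obtain l where l: "H a a = of_real l" for a
  proof
    fix a
    let ?h = "\<lambda>a. \<Sum>x\<in>X. m x * (norm ((T *v x) $ a))\<^sup>2"
    have "H a a = of_real (?h a)"
      unfolding H_def of_real_sum of_real_mult complex_norm_square by (rule refl)
    \<comment> \<open>Here \<open>undefined\<close> is merely a fixed reference index.\<close>
    also have "?h a = ?h undefined"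
      using diagonal_stationary[OF \<open>finite X\<close> \<open>p > 0\<close> det _ nz min, of a undefined]
      by (cases "a = undefined") (auto simp: m_def)
    finally show "H a a = of_real (?h undefined)" .
  qed
  have "(\<Sum>x\<in>X. m x * (norm (herm_inner (T *v x) u))\<^sup>2) = l * (norm u)\<^sup>2" for u
  proof -
    have "of_real (\<Sum>x\<in>X. m x * (norm (herm_inner (T *v x) u))\<^sup>2) =
        (\<Sum>x\<in>X. of_real (m x) * (herm_inner (T *v x) u * cnj (herm_inner (T *v x) u)))"
      by (simp only: of_real_sum of_real_mult complex_norm_square)
    also have "\<dots> = (\<Sum>x\<in>X. \<Sum>a\<in>UNIV. \<Sum>b\<in>UNIV.
        cnj (u $ a) * u $ b * (of_real (m x) * ((T *v x) $ a * cnj ((T *v x) $ b))))"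
      by (simp add: herm_inner_def sum_product sum_distrib_left ac_simps)
    also have "\<dots> = (\<Sum>a\<in>UNIV. \<Sum>b\<in>UNIV. cnj (u $ a) * u $ b * H a b)"
      unfolding H_def sum_distrib_left
      by (subst sum.swap, rule sum.cong, rule refl, subst sum.swap, rule refl)
    also have "\<dots> = (\<Sum>a\<in>UNIV. \<Sum>b\<in>UNIV. if b = a then cnj (u $ a) * u $ a * of_real l else 0)"
      by (intro sum.cong refl) (auto simp: off l)
    also have "\<dots> = (\<Sum>a\<in>UNIV. of_real l * (u $ a * cnj (u $ a)))"
      by (simp add: ac_simps)
    also have "\<dots> = of_real (l * (norm u)\<^sup>2)"
      unfolding norm_vec_power2 of_real_mult of_real_sum complex_norm_square sum_distrib_left
      by (rule refl)
    finally show ?thesis by (simp only: of_real_eq_iff)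
  qed
  then show thesis using that[OF inv, of l] by (simp add: m_def)
qed

subsection \<open>Angles between dependent vectors\<close>

text \<open>Division by zero gives 0 at zero vectors, so nonnegativity and symmetry hold without
  side conditions.\<close>

definition angle_cos2 :: "complex ^ 'n \<Rightarrow> complex ^ 'n \<Rightarrow> real" where
  "angle_cos2 x y = (norm (herm_inner x y))\<^sup>2 / ((norm x)\<^sup>2 * (norm y)\<^sup>2)"

lemma angle_cos2_nonneg: "angle_cos2 x y \<ge> 0"
  by (simp add: angle_cos2_def)

lemma angle_cos2_commute: "angle_cos2 x y = angle_cos2 y x"
  by (simp add: angle_cos2_def norm_herm_inner_commute[of x] mult.commute)

lemma angle_cos2_self: "x \<noteq> 0 \<Longrightarrow> angle_cos2 x x = 1"
  by (simp add: angle_cos2_def herm_inner_self norm_power power2_eq_square norm_mult)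

text \<open>With \<open>r = w - b *s y\<close> the two sides differ by exactly
  \<open>(norm (herm_inner r y))\<^sup>2\<close>: no multiple of \<open>y\<close> is closer to
  \<open>w\<close> than its orthogonal projection.\<close>

lemma norm_herm_inner_le_add:
  "(norm w)\<^sup>2 * (norm y)\<^sup>2 \<le> (norm (herm_inner w y))\<^sup>2 + (norm (w - b *s y))\<^sup>2 * (norm y)\<^sup>2"
proof -
  define r where "r = w - b *s y"
  have w: "w = r + b *s y" by (simp add: r_def)
  have "of_real ((norm w)\<^sup>2) = herm_inner w w" by (simp add: herm_inner_self)
  also have "\<dots> = of_real ((norm r)\<^sup>2) + b * cnj (herm_inner r y) + cnj b * herm_inner r y + b * cnj b * of_real ((norm y)\<^sup>2)"
    unfolding w unfolding herm_inner_add_left herm_inner_add_right herm_inner_smult_left herm_inner_smult_right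
    unfolding herm_inner_self cnj_herm_inner by (simp add: algebra_simps)
  finally have 1: "complex_of_real ((norm w)\<^sup>2) = \<dots>" .
  have wy: "herm_inner w y = herm_inner r y + b * of_real ((norm y)\<^sup>2)"
    unfolding w by (simp add: herm_inner_add_left herm_inner_smult_left herm_inner_self)
  have 2: "complex_of_real ((norm (herm_inner w y))\<^sup>2) =
      (herm_inner r y + b * of_real ((norm y)\<^sup>2)) * (cnj (herm_inner r y) + cnj b * of_real ((norm y)\<^sup>2))"
    unfolding complex_norm_square wy by simp
  have "complex_of_real ((norm w)\<^sup>2 * (norm y)\<^sup>2 + (norm (herm_inner r y))\<^sup>2) =
      of_real ((norm (herm_inner w y))\<^sup>2 + (norm r)\<^sup>2 * (norm y)\<^sup>2)"
    unfolding of_real_add of_real_mult 1 2 complex_norm_square[of "herm_inner r y"] by (simp add: algebra_simps)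
  then have "(norm w)\<^sup>2 * (norm y)\<^sup>2 + (norm (herm_inner r y))\<^sup>2 =
      (norm (herm_inner w y))\<^sup>2 + (norm r)\<^sup>2 * (norm y)\<^sup>2"
    by (simp only: of_real_eq_iff)
  moreover have "(norm (herm_inner r y))\<^sup>2 \<ge> 0" by simp
  ultimately show ?thesis unfolding r_def by linarith
qed

text \<open>The hypothesis bounds the sine of the angle by 1/2, and 3/4 = 1 - (1/2)^2.\<close>

lemma angle_cos2_ge_near:
  assumes "w \<noteq> 0" "y \<noteq> 0" and "norm (w - b *s y) \<le> norm w / 2"
  shows "angle_cos2 w y \<ge> 3 / 4"
proof -
  have "(norm (w - b *s y))\<^sup>2 \<le> (norm w)\<^sup>2 / 4"
    using power_mono[OF assms(3), of 2] by (simp add: power_divide)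
  then have "(norm (w - b *s y))\<^sup>2 * (norm y)\<^sup>2 \<le> (norm w)\<^sup>2 / 4 * (norm y)\<^sup>2"
    by (rule mult_right_mono) simp
  with norm_herm_inner_le_add[of w y b]
  have "3 / 4 * ((norm w)\<^sup>2 * (norm y)\<^sup>2) \<le> (norm (herm_inner w y))\<^sup>2" by simp
  then show ?thesis using assms by (simp add: angle_cos2_def field_simps)
qed

text \<open>The vanishing of the Gram determinant of \<open>x\<close>, \<open>y\<close>, \<open>w\<close>, with the negative terms moved to the right.\<close>

lemma gram_dependent:
  fixes x y w :: "complex ^ 'n"
  assumes "w = a *s x + b *s y"
  shows "herm_inner x x * herm_inner y y * herm_inner w w + 2 * of_real (Re (herm_inner x y * herm_inner y w * herm_inner w x)) =
    herm_inner x x * of_real ((norm (herm_inner y w))\<^sup>2) + herm_inner y y * of_real ((norm (herm_inner x w))\<^sup>2) +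
    herm_inner w w * of_real ((norm (herm_inner x y))\<^sup>2)"
proof -
  have re: "2 * of_real (Re (herm_inner x y * herm_inner y w * herm_inner w x)) =
      herm_inner x y * herm_inner y w * herm_inner w x + herm_inner y x * herm_inner w y * herm_inner x w"
    using complex_add_cnj[of "herm_inner x y * herm_inner y w * herm_inner w x"] by (simp add: cnj_herm_inner)
  have nm: "of_real ((norm (herm_inner u v))\<^sup>2) = herm_inner u v * herm_inner v u" for u v :: "complex ^ 'n"
    by (simp only: complex_norm_square cnj_herm_inner)
  have hw: "herm_inner w u = a * herm_inner x u + b * herm_inner y u" for u
    by (simp add: assms herm_inner_add_left herm_inner_smult_left)
  show ?thesis
    unfolding re unfolding nm unfolding hw by algebra
qed

text \<open>Cauchy-Schwarz gives \<open>x + y + z < 3 / 2\<close>, and then AM-GM gives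
  \<open>x * y * z < 1 / 8\<close>.\<close>

lemma prod_less_of_sum_squares_less:
  fixes x y z :: real
  assumes "x \<ge> 0" "y \<ge> 0" "z \<ge> 0" and "x\<^sup>2 + y\<^sup>2 + z\<^sup>2 < 3 / 4"
  shows "2 * (x * y * z) < 1 / 4"
proof -
  define s where "s = x + y + z"
  have "s\<^sup>2 \<le> 3 * (x\<^sup>2 + y\<^sup>2 + z\<^sup>2)"
  proof -
    have "3 * (x\<^sup>2 + y\<^sup>2 + z\<^sup>2) - s\<^sup>2 = (x - y)\<^sup>2 + (y - z)\<^sup>2 + (x - z)\<^sup>2"
      unfolding s_def by (simp add: power2_eq_square algebra_simps)
    then show ?thesis by (smt (verit) zero_le_power2)
  qed
  then have "s\<^sup>2 < (3 / 2)\<^sup>2" using assms(4) by (simp add: power2_eq_square)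
  then have s: "s < 3 / 2" by (rule power2_less_imp_less) simp
  have "s ^ 3 - 27 * (x * y * z) \<ge> 0"
  proof -
    \<comment> \<open>AM-GM, with its defect written as a sum of nonnegative terms.\<close>
    have "2 * (s ^ 3 - 27 * (x * y * z)) =
        x * (y - z)\<^sup>2 * 7 + y * (x - z)\<^sup>2 * 7 + z * (x - y)\<^sup>2 * 7 +
        (x + y) * (x - y)\<^sup>2 + (y + z) * (y - z)\<^sup>2 + (x + z) * (x - z)\<^sup>2"
      unfolding s_def by (simp add: power2_eq_square power3_eq_cube algebra_simps)
    also have "\<dots> \<ge> 0" using assms by simp
    finally show ?thesis by simp
  qed
  moreover have "s ^ 3 < (3 / 2) ^ 3"
    using s assms by (intro power_strict_mono) (auto simp: s_def)
  ultimately show ?thesis by (simp add: power3_eq_cube)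
qed

text \<open>Normalizing the Gram identity bounds the sum of squared cosines below by 1 minus twice
  the product of the cosines. A sum under 3/4 would make that more than 3/4. Equality occurs for
  three lines of a plane at mutual angles of 60 degrees.\<close>

lemma angle_cos2_dependent:
  fixes x y w :: "complex ^ 'n"
  assumes nz: "x \<noteq> 0" "y \<noteq> 0" "w \<noteq> 0" and dep: "w = a *s x + b *s y"
  shows "angle_cos2 x y + angle_cos2 y w + angle_cos2 x w \<ge> 3 / 4"
proof (rule ccontr)
  define f where "f u v = norm (herm_inner u v) / (norm u * norm v)" for u v :: "complex ^ 'n"
  have sq: "angle_cos2 u v = (f u v)\<^sup>2" for u v :: "complex ^ 'n"
    by (simp add: angle_cos2_def f_def power_divide power_mult_distrib)
  assume neg: "\<not> ?thesis"
  then have "2 * (f x y * f y w * f x w) < 1 / 4"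
    by (intro prod_less_of_sum_squares_less) (auto simp: sq f_def)
  define r where "r = Re (herm_inner x y * herm_inner y w * herm_inner w x)"
  have "complex_of_real ((norm x)\<^sup>2 * (norm y)\<^sup>2 * (norm w)\<^sup>2 + 2 * r) =
      of_real ((norm x)\<^sup>2 * (norm (herm_inner y w))\<^sup>2 + (norm y)\<^sup>2 * (norm (herm_inner x w))\<^sup>2
        + (norm w)\<^sup>2 * (norm (herm_inner x y))\<^sup>2)"
    using gram_dependent[OF dep] unfolding r_def herm_inner_self of_real_add of_real_mult by simp
  then have "(norm x)\<^sup>2 * (norm y)\<^sup>2 * (norm w)\<^sup>2 + 2 * r =
      (norm x)\<^sup>2 * (norm (herm_inner y w))\<^sup>2 + (norm y)\<^sup>2 * (norm (herm_inner x w))\<^sup>2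
        + (norm w)\<^sup>2 * (norm (herm_inner x y))\<^sup>2"
    by (simp only: of_real_eq_iff)
  moreover have "r \<ge> - (norm (herm_inner x y) * norm (herm_inner y w) * norm (herm_inner x w))"
    using abs_Re_le_cmod[of "herm_inner x y * herm_inner y w * herm_inner w x"]
    by (simp add: r_def norm_mult norm_herm_inner_commute[of w])
  ultimately have "(norm x)\<^sup>2 * (norm y)\<^sup>2 * (norm w)\<^sup>2
      - 2 * (norm (herm_inner x y) * norm (herm_inner y w) * norm (herm_inner x w)) \<le>
      (norm x)\<^sup>2 * (norm (herm_inner y w))\<^sup>2 + (norm y)\<^sup>2 * (norm (herm_inner x w))\<^sup>2
        + (norm w)\<^sup>2 * (norm (herm_inner x y))\<^sup>2" by linarith
  moreover have "norm (herm_inner u v) = f u v * (norm u * norm v)" if "u \<noteq> 0" "v \<noteq> 0" for u v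
    using that by (simp add: f_def)
  ultimately have "(norm x * norm y * norm w)\<^sup>2 * (1 - 2 * (f x y * f y w * f x w)) \<le>
      (norm x * norm y * norm w)\<^sup>2 * ((f x y)\<^sup>2 + (f y w)\<^sup>2 + (f x w)\<^sup>2)"
    using nz by (simp add: power2_eq_square algebra_simps)
  then have "1 - 2 * (f x y * f y w * f x w) \<le> (f x y)\<^sup>2 + (f y w)\<^sup>2 + (f x w)\<^sup>2"
    using nz by (subst (asm) mult_le_cancel_left_pos) auto
  with \<open>2 * (f x y * f y w * f x w) < 1 / 4\<close> neg show False by (simp add: sq)
qed

subsection \<open>Weights of collinear triples\<close>

text \<open>
  Completing \<open>V\<close> by basis vectors to a spanning set costs at most the codimension in total weight,
  because no single weight exceeds 1.
\<close>

lemma isotropic_weights: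
  fixes V :: "(complex ^ 'n) set"
  assumes "finite V" "0 \<notin> V" "p > 0"
  obtains T :: "complex ^ 'n ^ 'n" and l :: real where "invertible T" "l > 0"
    and "real (vec.dim V) \<le> (\<Sum>x\<in>V. norm (T *v x) powr p / l)"
    and "\<And>y. y \<in> V \<Longrightarrow> (\<Sum>x\<in>V. norm (T *v x) powr p / l * angle_cos2 (T *v x) (T *v y)) \<le> 1"
proof -
  obtain B\<^sub>0 where B0: "B\<^sub>0 \<subseteq> V" "vec.independent B\<^sub>0" "card B\<^sub>0 = vec.dim V"
    by (rule vec.basis_exists)
  obtain B where B: "B\<^sub>0 \<subseteq> B" "vec.independent B" "UNIV \<subseteq> vec.span B"
    using vec.maximal_independent_subset_extend[OF subset_UNIV B0(2)] by metis
  have finB: "finite B" using B(2) by (rule vec.finiteI_independent)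
  have cardB: "card B = CARD('n)"
    using B(2,3) by (metis vec.dim_eq_card_independent vec.dim_eq_full vec_dim_card top.extremum_uniqueI
        vec.dim_span)
  define X where "X = V \<union> B"
  have finX: "finite X" using finB assms by (simp add: X_def)
  have span: "vec.span X = UNIV"
    using vec.span_mono[of B X] B(3) by (auto simp: X_def)
  have X0: "0 \<notin> X"
    using B(2) vec.dependent_zero[of B] \<open>0 \<notin> V\<close> by (auto simp: X_def)
  obtain T :: "complex ^ 'n ^ 'n" and l where T: "invertible T" and
    iso: "\<And>u. (\<Sum>x\<in>X. norm (T *v x) powr (p - 2) * (norm (herm_inner (T *v x) u))\<^sup>2) = l * (norm u)\<^sup>2"
    using isotropic_position[OF finX span X0 \<open>p > 0\<close>] by blast
  have nz: "T *v x \<noteq> 0" if "x \<in> X" for x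
    using T that X0 by (metis inj_matrix_vector_mult injD matrix_vector_mult_0_right)
  have powr_p: "norm (T *v x) powr p = norm (T *v x) powr (p - 2) * (norm (T *v x))\<^sup>2" if "x \<in> X" for x
    using nz[OF that] by (simp add: powr_diff)
  \<comment> \<open>Trace of the isotropy identity: summing over all \<open>axis a 1\<close> gives
    total weight \<open>l * CARD('n)\<close>.\<close>
  have "(\<Sum>x\<in>X. norm (T *v x) powr p) =
      (\<Sum>x\<in>X. \<Sum>a\<in>UNIV. norm (T *v x) powr (p - 2) * (norm (herm_inner (T *v x) (axis a 1)))\<^sup>2)"
    by (rule sum.cong) (simp_all add: powr_p norm_vec_power2[of "T *v _"] sum_distrib_left herm_inner_def axis_def
        if_distrib[of cnj] if_distrib[of "\<lambda>c. _ * c"] cong: if_cong)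
  also have "\<dots> = (\<Sum>a\<in>(UNIV :: 'n set). l)"
    by (subst sum.swap) (simp add: iso)
  finally have total: "(\<Sum>x\<in>X. norm (T *v x) powr p) = l * CARD('n)" by simp
  have "X \<noteq> {}" using cardB by (auto simp: X_def)
  then have "(\<Sum>x\<in>X. norm (T *v x) powr p) > 0"
    using finX nz by (intro sum_pos) auto
  then have "l > 0" by (simp add: total zero_less_mult_iff)
  define c where "c x = norm (T *v x) powr p / l" for x
  define g where "g x y = angle_cos2 (T *v x) (T *v y)" for x y
  have c: "c x \<ge> 0" for x using \<open>l > 0\<close> by (simp add: c_def)
  have g: "g x y \<ge> 0" for x y by (simp add: g_def angle_cos2_nonneg)
  have row: "(\<Sum>x\<in>X. c x * g x y) = 1" if "y \<in> X" for y
  proof -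
    have "(\<Sum>x\<in>X. c x * g x y) =
        (\<Sum>x\<in>X. norm (T *v x) powr (p - 2) * (norm (herm_inner (T *v x) (T *v y)))\<^sup>2) / (l * (norm (T *v y))\<^sup>2)"
      unfolding sum_divide_distrib c_def g_def angle_cos2_def
      by (rule sum.cong) (use nz that \<open>l > 0\<close> in \<open>auto simp: powr_p field_simps\<close>)
    also have "\<dots> = 1" using nz[OF that] \<open>l > 0\<close> by (simp add: iso)
    finally show ?thesis .
  qed
  \<comment> \<open>The diagonal term of a row sum equal to 1 is \<open>c y\<close> itself.\<close>
  have c1: "c y \<le> 1" if "y \<in> X" for y
  proof -
    have "c y * g y y \<le> (\<Sum>x\<in>X. c x * g x y)"
      using finX that c g by (intro member_le_sum) auto
    then show ?thesis using row[OF that] nz[OF that] by (simp add: g_def angle_cos2_self)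
  qed
  have "vec.dim V \<le> CARD('n)" using vec.dim_subset[OF subset_UNIV, of V] unfolding vec_dim_card .
  have "(\<Sum>x\<in>X. c x) = CARD('n)"
    using total \<open>l > 0\<close> by (simp add: c_def flip: sum_divide_distrib)
  moreover have "(\<Sum>x\<in>X. c x) = (\<Sum>x\<in>V. c x) + (\<Sum>x\<in>X - V. c x)"
    using finX by (subst sum.subset_diff[of V]) (auto simp: X_def)
  moreover have "(\<Sum>x\<in>X - V. c x) \<le> card (X - V)"
    using sum_bounded_above[of "X - V" c 1] c1 by simp
  moreover have "card (X - V) \<le> card (B - B\<^sub>0)"
    using finB B0(1) by (intro card_mono) (auto simp: X_def)
  moreover have "card (B - B\<^sub>0) = CARD('n) - vec.dim V"
    using B(1) finB B0(3) cardB by (simp add: card_Diff_subset finite_subset)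
  ultimately have "real (vec.dim V) \<le> (\<Sum>x\<in>V. c x)"
    using \<open>vec.dim V \<le> CARD('n)\<close> by linarith
  moreover have "(\<Sum>x\<in>V. c x * g x y) \<le> 1" if "y \<in> V" for y
  proof -
    have "(\<Sum>x\<in>V. c x * g x y) \<le> (\<Sum>x\<in>X. c x * g x y)"
      using finX c g by (intro sum_mono2) (auto simp: X_def)
    also have "\<dots> = 1" using that by (intro row) (simp add: X_def)
    finally show ?thesis .
  qed
  ultimately show thesis using that[OF T \<open>l > 0\<close>] by (simp add: c_def g_def)
qed

text \<open>Weights increase with length. If they are comparable,
  \<open>angle_cos2_dependent\<close> applies with the smallest weight throughout; otherwise
  \<open>u\<close> is so short that \<open>w\<close> lies close to a multiple of \<open>v\<close>,
  and the pair \<open>v\<close>, \<open>w\<close> suffices.\<close>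

lemma weighted_triple_sorted:
  fixes u v w :: "complex ^ 'n"
  assumes nz: "u \<noteq> 0" "v \<noteq> 0" "w \<noteq> 0" and "l > 0" "p > 0" "0 < \<eta>" "\<eta> < 1"
    and small: "(1 - \<eta>) powr (1 / p) * C \<le> 1 / 2"
    and sorted: "norm u \<le> norm v" "norm v \<le> norm w"
    and dep: "w = a *s u + b *s v" "norm a \<le> C"
  defines "c \<equiv> \<lambda>x :: complex ^ 'n. norm x powr p / l"
  shows "(1 - \<eta>) / 2 * (c u + c v + c w) \<le>
    (c u + c v) * angle_cos2 u v + (c v + c w) * angle_cos2 v w + (c u + c w) * angle_cos2 u w"
proof -
  have pos: "c x \<ge> 0" for x using \<open>l > 0\<close> by (simp add: c_def)
  have mono: "c u \<le> c v" "c v \<le> c w"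
    using sorted \<open>p > 0\<close> \<open>l > 0\<close> by (auto simp: c_def intro!: divide_right_mono powr_mono2)
  show ?thesis
  proof (cases "(1 - \<eta>) * c w \<le> c u")
    case True
    let ?S = "angle_cos2 u v + angle_cos2 v w + angle_cos2 u w"
    have "(1 - \<eta>) / 2 * (c u + c v + c w) \<le> (1 - \<eta>) / 2 * (3 * c w)"
      using mono \<open>\<eta> < 1\<close> by (intro mult_left_mono) auto
    also have "\<dots> \<le> 2 * c u * (3 / 4)" using True by (simp add: mult.commute)
    also have "\<dots> \<le> 2 * c u * ?S"
      using angle_cos2_dependent[OF nz dep(1)] pos by (intro mult_left_mono) auto
    also have "\<dots> = 2 * c u * angle_cos2 u v + 2 * c u * angle_cos2 v w + 2 * c u * angle_cos2 u w"
      by (simp add: algebra_simps)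
    also have "\<dots> \<le> (c u + c v) * angle_cos2 u v + (c v + c w) * angle_cos2 v w + (c u + c w) * angle_cos2 u w"
      using mono by (intro add_mono mult_right_mono angle_cos2_nonneg) auto
    finally show ?thesis .
  next
    case False
    then have "norm u powr p / l \<le> (1 - \<eta>) * norm w powr p / l" by (simp add: c_def)
    then have "norm u powr p \<le> (1 - \<eta>) * norm w powr p"
      using \<open>l > 0\<close> by (simp add: divide_le_cancel)
    \<comment> \<open>Taking \<open>p\<close>-th roots turns a mild gap between weights into a large
      gap between lengths, which absorbs the coefficient bound \<open>C\<close>.\<close>
    then have "(norm u powr p) powr (1 / p) \<le> ((1 - \<eta>) * norm w powr p) powr (1 / p)"
      using \<open>p > 0\<close> by (intro powr_mono2) auto
    then have "norm u \<le> (1 - \<eta>) powr (1 / p) * norm w"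
      using \<open>p > 0\<close> \<open>\<eta> < 1\<close> by (simp add: powr_mult powr_powr)
    then have "norm a * norm u \<le> C * ((1 - \<eta>) powr (1 / p) * norm w)"
      using dep(2) by (intro mult_mono) (auto intro: order.trans[OF norm_ge_zero])
    also have "\<dots> \<le> 1 / 2 * norm w"
      using mult_right_mono[OF small norm_ge_zero[of w]] by (simp add: ac_simps)
    finally have "norm (w - b *s v) \<le> norm w / 2"
      by (simp add: dep(1) norm_vec_smult)
    then have "angle_cos2 v w \<ge> 3 / 4"
      using angle_cos2_ge_near[OF nz(3,2)] by (simp add: angle_cos2_commute[of v])
    \<comment> \<open>The smallest weight \<open>c u\<close> is at most half of
      \<open>c v + c w\<close>.\<close>
    have "(1 - \<eta>) / 2 * (c u + c v + c w) \<le> 1 / 2 * (3 / 2 * (c v + c w))"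
      using mono pos[of u] pos[of v] pos[of w] \<open>0 < \<eta>\<close> \<open>\<eta> < 1\<close> by (intro mult_mono) auto
    also have "\<dots> = (c v + c w) * (3 / 4)" by simp
    also have "\<dots> \<le> (c v + c w) * angle_cos2 v w"
      using \<open>angle_cos2 v w \<ge> 3 / 4\<close> pos[of v] pos[of w] by (intro mult_left_mono) auto
    also have "\<dots> \<le> (c u + c v) * angle_cos2 u v + (c v + c w) * angle_cos2 v w + (c u + c w) * angle_cos2 u w"
      by (simp add: pos angle_cos2_nonneg)
    finally show ?thesis .
  qed
qed

text \<open>The inequality is symmetric, so the vectors may be sorted by length. Which one is
  shortest depends on \<open>T\<close> in the application, hence the dependence hypothesis for every
  ordering.\<close>

lemma weighted_triple:
  fixes u v w :: "complex ^ 'n"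
  assumes nz: "u \<noteq> 0" "v \<noteq> 0" "w \<noteq> 0" and l: "l > 0" "p > 0" "0 < \<eta>" "\<eta> < 1"
    and small: "(1 - \<eta>) powr (1 / p) * C \<le> 1 / 2"
    and dep: "\<And>x y z. {x, y, z} = {u, v, w} \<Longrightarrow> \<exists>a b. z = a *s x + b *s y \<and> norm a \<le> C"
  defines "c \<equiv> \<lambda>x :: complex ^ 'n. norm x powr p / l"
  shows "(1 - \<eta>) / 2 * (c u + c v + c w) \<le>
    (c u + c v) * angle_cos2 u v + (c v + c w) * angle_cos2 v w + (c u + c w) * angle_cos2 u w"
proof -
  have *: "(1 - \<eta>) / 2 * (c x + c y + c z) \<le>
      (c x + c y) * angle_cos2 x y + (c y + c z) * angle_cos2 y z + (c x + c z) * angle_cos2 x z"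
    if perm: "{x, y, z} = {u, v, w}" and le: "norm x \<le> norm y" "norm y \<le> norm z" for x y z
  proof -
    obtain a b where "z = a *s x + b *s y" "norm a \<le> C" using dep[OF perm] by blast
    moreover have "x \<noteq> 0" "y \<noteq> 0" "z \<noteq> 0" using perm nz by auto
    ultimately show ?thesis
      unfolding c_def using weighted_triple_sorted[OF _ _ _ l small le] by blast
  qed
  note comm = angle_cos2_commute[of v u] angle_cos2_commute[of w u] angle_cos2_commute[of w v]
  consider "norm u \<le> norm v" "norm v \<le> norm w" | "norm u \<le> norm w" "norm w \<le> norm v"
    | "norm v \<le> norm u" "norm u \<le> norm w" | "norm v \<le> norm w" "norm w \<le> norm u"
    | "norm w \<le> norm u" "norm u \<le> norm v" | "norm w \<le> norm v" "norm v \<le> norm u"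
    by linarith
  then show ?thesis
  proof cases
    case 1 then show ?thesis using *[of u v w] by auto
  next
    case 2 then show ?thesis using *[of u w v] by (auto simp: comm algebra_simps)
  next
    case 3 then show ?thesis using *[of v u w] by (auto simp: comm algebra_simps)
  next
    case 4 then show ?thesis using *[of v w u] by (auto simp: comm algebra_simps)
  next
    case 5 then show ?thesis using *[of w u v] by (auto simp: comm algebra_simps)
  next
    case 6 then show ?thesis using *[of w v u] by (auto simp: comm algebra_simps)
  qed
qed

text \<open>
  Each triple \<open>R x y z\<close> is weighted by the reciprocal of the number of points on its line other than \<open>x\<close>
  and \<open>y\<close>; this number depends on the line only, so the weight is symmetric in \<open>x\<close>, \<open>y\<close>, \<open>z\<close>.
\<close>

lemma averaging_over_triples:
  fixes R :: "'a \<Rightarrow> 'a \<Rightarrow> 'a \<Rightarrow> bool" and c :: "'a \<Rightarrow> real" and g :: "'a \<Rightarrow> 'a \<Rightarrow> real"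
  assumes "finite V"
    and R_swap12: "\<And>x y z. R x y z \<Longrightarrow> R y x z" and R_swap23: "\<And>x y z. R x y z \<Longrightarrow> R x z y"
    and R_distinct: "\<And>x y z. R x y z \<Longrightarrow> y \<noteq> z"
    and R_trans: "\<And>x y z w. R x y z \<Longrightarrow> R x y w \<Longrightarrow> z \<noteq> w \<Longrightarrow> R x z w"
    and g_sym: "\<And>x y. g x y = g y x" and g_nonneg: "\<And>x y. g x y \<ge> 0" and c_nonneg: "\<And>x. c x \<ge> 0"
    and "k \<ge> 0"
    and triple: "\<And>x y z. x \<in> V \<Longrightarrow> y \<in> V \<Longrightarrow> z \<in> V \<Longrightarrow> R x y z \<Longrightarrow>
      k * (c x + c y + c z) \<le> (c x + c y) * g x y + (c y + c z) * g y z + (c x + c z) * g x z"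
    and deg: "\<And>x. x \<in> V \<Longrightarrow> d \<le> real (card {y \<in> V. \<exists>z\<in>V. R x y z})"
  shows "k / 2 * d * (\<Sum>x\<in>V. c x) \<le> (\<Sum>x\<in>V. \<Sum>y\<in>V - {x}. c y * g x y)"
proof -
  define A where "A x y = {z \<in> V. R x y z}" for x y
  define W where "W x y z = (if R x y z then 1 / real (card (A x y)) else 0)" for x y z
  define S where "S f = (\<Sum>x\<in>V. \<Sum>y\<in>V. \<Sum>z\<in>V. W x y z * f x y z)" for f
  have finA: "finite (A x y)" for x y using \<open>finite V\<close> by (simp add: A_def)
  have A_comm: "A x y = A y x" for x y
    unfolding A_def using R_swap12 by blast
  have cardA: "card (A x y) = card (A x z)" if "y \<in> V" "z \<in> V" "R x y z" for x y z
  proof -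
    \<comment> \<open>Both sides are the points of the common line other than
      \<open>x\<close>.\<close>
    have "insert y (A x y) = insert z (A x z)"
      using that R_swap23 R_trans unfolding A_def by blast
    moreover have "y \<notin> A x y" "z \<notin> A x z"
      using R_distinct by (auto simp: A_def)
    ultimately show ?thesis using finA by (metis card_insert_disjoint nat.inject)
  qed
  have W23: "W x z y = W x y z" if "y \<in> V" "z \<in> V" for x y z
  proof (cases "R x y z")
    case True
    then show ?thesis using cardA[OF that] R_swap23[of x y z] by (simp add: W_def)
  next
    case False
    then show ?thesis using R_swap23[of x z y] by (auto simp: W_def)
  qed
  have W12: "W y x z = W x y z" for x y z
    using R_swap12[of x y z] R_swap12[of y x z] unfolding W_def A_comm[of x y] by auto
  have S12: "S (\<lambda>x y z. f y x z) = S f" for f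
    unfolding S_def by (subst sum.swap) (simp add: W12)
  have S23: "S (\<lambda>x y z. f x z y) = S f" for f
  proof -
    have "(\<Sum>y\<in>V. \<Sum>z\<in>V. W x y z * f x z y) = (\<Sum>y\<in>V. \<Sum>z\<in>V. W x y z * f x y z)" for x
      by (subst sum.swap, intro sum.cong refl) (simp add: W23)
    then show ?thesis by (simp add: S_def)
  qed
  have S_add: "S (\<lambda>x y z. f x y z + h x y z) = S f + S h" for f h
    by (simp add: S_def algebra_simps sum.distrib)
  \<comment> \<open>The normalization makes summing over \<open>z\<close> count each pair with a
    third point exactly once.\<close>
  have W_sum: "(\<Sum>z\<in>V. W x y z) = (if A x y = {} then 0 else 1)" for x y
  proof -
    have "(\<Sum>z\<in>V. W x y z) = (\<Sum>z\<in>A x y. 1 / real (card (A x y)))"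
      unfolding A_def W_def using \<open>finite V\<close> by (simp add: sum.If_cases Int_def)
    then show ?thesis using finA by simp
  qed
  have S_pairs: "S (\<lambda>x y z. f x y) = (\<Sum>x\<in>V. \<Sum>y\<in>V. if A x y = {} then 0 else f x y)" for f
    unfolding S_def by (intro sum.cong refl) (simp add: W_sum flip: sum_distrib_right)
  \<comment> \<open>By the symmetry of \<open>W\<close>, all six products on the right of
    \<open>triple\<close> have the same sum \<open>Q\<close>, and the three weights on its left also
    share one sum.\<close>
  define Q where "Q = S (\<lambda>x y z. c y * g x y)"
  have f1: "S (\<lambda>x y z. c y * g x y) = Q" by (simp add: Q_def)
  have f2: "S (\<lambda>x y z. c x * g x y) = Q"
    using S12[of "\<lambda>x y z. c y * g x y"] by (simp add: Q_def g_sym)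
  have f3: "S (\<lambda>x y z. c z * g x z) = Q" using S23[of "\<lambda>x y z. c y * g x y"] by (simp add: Q_def)
  have f4: "S (\<lambda>x y z. c x * g x z) = Q" using S23[of "\<lambda>x y z. c x * g x y"] f2 by simp
  have f5: "S (\<lambda>x y z. c z * g y z) = Q" using S12[of "\<lambda>x y z. c z * g x z"] f3 by simp
  have f6: "S (\<lambda>x y z. c y * g y z) = Q" using S12[of "\<lambda>x y z. c x * g x z"] f4 by simp
  have e2: "S (\<lambda>x y z. c y) = S (\<lambda>x y z. c x)" using S12[of "\<lambda>x y z. c x"] by simp
  have e3: "S (\<lambda>x y z. c z) = S (\<lambda>x y z. c x)" using S23[of "\<lambda>x y z. c y"] e2 by simp
  have "3 * k * S (\<lambda>x y z. c x) = k * (S (\<lambda>x y z. c x) + S (\<lambda>x y z. c y) + S (\<lambda>x y z. c z))"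
    unfolding e2 e3 by simp
  also have "\<dots> = S (\<lambda>x y z. k * (c x + c y + c z))"
    by (simp add: S_def sum_distrib_left sum.distrib algebra_simps)
  also have "\<dots> \<le> S (\<lambda>x y z. (c x + c y) * g x y + (c y + c z) * g y z + (c x + c z) * g x z)"
    unfolding S_def by (intro sum_mono) (auto simp: W_def intro!: divide_right_mono triple)
  also have "\<dots> = 6 * Q"
    unfolding distrib_right S_add f1 f2 f3 f4 f5 f6 by simp
  finally have "k / 2 * S (\<lambda>x y z. c x) \<le> Q" by simp
  moreover have "d * (\<Sum>x\<in>V. c x) \<le> S (\<lambda>x y z. c x)"
  proof -
    have "{y \<in> V. \<exists>z\<in>V. R x y z} = {y \<in> V. A x y \<noteq> {}}" for x
      by (auto simp: A_def)
    then have "d * (\<Sum>x\<in>V. c x) \<le> (\<Sum>x\<in>V. real (card {y \<in> V. A x y \<noteq> {}}) * c x)"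
      unfolding sum_distrib_left using deg by (intro sum_mono mult_right_mono c_nonneg) simp
    also have "\<dots> = S (\<lambda>x y z. c x)"
      unfolding S_pairs using \<open>finite V\<close>
      by (intro sum.cong refl) (simp add: sum.If_cases Int_def)
    finally show ?thesis .
  qed
  then have "k / 2 * (d * (\<Sum>x\<in>V. c x)) \<le> k / 2 * S (\<lambda>x y z. c x)"
    using \<open>k \<ge> 0\<close> by (intro mult_left_mono) auto
  moreover have "Q \<le> (\<Sum>x\<in>V. \<Sum>y\<in>V - {x}. c y * g x y)"
    unfolding Q_def S_pairs
  proof (rule sum_mono)
    fix x assume "x \<in> V"
    \<comment> \<open>This removes the diagonal, where \<open>g x x\<close> would otherwise
      enter.\<close>
    have "A x x = {}" using R_distinct R_swap12 R_swap23 unfolding A_def by blast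
    then have "(\<Sum>y\<in>V. if A x y = {} then 0 else c y * g x y) =
        (\<Sum>y\<in>V - {x}. if A x y = {} then 0 else c y * g x y)"
      using \<open>finite V\<close> \<open>x \<in> V\<close> by (simp add: sum.remove)
    also have "\<dots> \<le> (\<Sum>y\<in>V - {x}. c y * g x y)"
      using c_nonneg g_nonneg by (intro sum_mono) auto
    finally show "(\<Sum>y\<in>V. if A x y = {} then 0 else c y * g x y) \<le> (\<Sum>y\<in>V - {x}. c y * g x y)" .
  qed
  ultimately show ?thesis by (simp add: mult.assoc)
qed

subsection \<open>Lines and homogeneous coordinates\<close>

text \<open>Any two distinct points parametrize the line; consequently two lines sharing two points
  coincide.\<close>

lemma complex_line_through:
  assumes "complex_line L" "x \<in> L" "y \<in> L" "x \<noteq> y"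
  shows "L = range (\<lambda>t. x + t *s (y - x))"
proof -
  obtain a u where "u \<noteq> 0" and L: "L = {a + t *s u | t. True}"
    using assms(1) by (auto simp: complex_line_def)
  obtain s r where x: "x = a + s *s u" and y: "y = a + r *s u"
    using assms(2,3) by (auto simp: L)
  have "r \<noteq> s" using x y \<open>x \<noteq> y\<close> by auto
  have yx: "y - x = (r - s) *s u" by (simp add: x y vec_eq_iff algebra_simps)
  have "((t - s) / (r - s)) *s (y - x) = (t - s) *s u" for t
    unfolding yx vector_smult_assoc using \<open>r \<noteq> s\<close> by simp
  then have 1: "a + t *s u = x + ((t - s) / (r - s)) *s (y - x)" for t
    by (simp add: x vec_eq_iff algebra_simps)
  have 2: "x + t *s (y - x) = a + (s + t * (r - s)) *s u" for t
    unfolding yx by (simp add: x vec_eq_iff algebra_simps)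
  show ?thesis
  proof
    show "L \<subseteq> range (\<lambda>t. x + t *s (y - x))"
      unfolding L by clarify (rule range_eqI, rule 1)
    show "range (\<lambda>t. x + t *s (y - x)) \<subseteq> L"
      unfolding L using 2 by blast
  qed
qed

text \<open>The cardinality expresses distinctness through the set \<open>{x, y, z}\<close> alone,
  so invariance under permutations is immediate.\<close>

definition collinear_triple :: "complex ^ 'd \<Rightarrow> complex ^ 'd \<Rightarrow> complex ^ 'd \<Rightarrow> bool" where
  "collinear_triple x y z \<longleftrightarrow> card {x, y, z} = 3 \<and> (\<exists>L. complex_line L \<and> {x, y, z} \<subseteq> L)"

lemma card_eq_3_distinct: "card {x, y, z} = 3 \<longleftrightarrow> x \<noteq> y \<and> y \<noteq> z \<and> x \<noteq> z"
  by (auto simp: card_insert_if)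

lemma collinear_triple_trans:
  assumes "collinear_triple x y z" "collinear_triple x y w" "z \<noteq> w"
  shows "collinear_triple x z w"
proof -
  obtain L M where L: "complex_line L" "{x, y, z} \<subseteq> L" and M: "complex_line M" "{x, y, w} \<subseteq> M"
    using assms by (auto simp: collinear_triple_def)
  have "x \<noteq> y" "x \<noteq> z" "x \<noteq> w"
    using assms by (auto simp: collinear_triple_def card_eq_3_distinct)
  then have "L = M"
    using complex_line_through[of L x y] complex_line_through[of M x y] L M by auto
  then show ?thesis
    using L M \<open>x \<noteq> z\<close> \<open>x \<noteq> w\<close> \<open>z \<noteq> w\<close> by (auto simp: collinear_triple_def card_eq_3_distinct)
qed

text \<open>The index type \<open>'d option\<close> supplies one extra coordinate, fixed at 1, so
  that affine relations become linear ones.\<close>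

definition homogenize :: "complex ^ 'd \<Rightarrow> complex ^ ('d option)" where
  "homogenize v = (\<chi> i. case i of None \<Rightarrow> 1 | Some j \<Rightarrow> v $ j)"

lemma homogenize_nth [simp]: "homogenize v $ None = 1" "homogenize v $ Some j = v $ j"
  by (simp_all add: homogenize_def)

lemma inj_homogenize: "inj homogenize"
  by (rule injI) (metis homogenize_nth(2) vec_eq_iff)

lemma homogenize_nonzero: "homogenize v \<noteq> 0"
  by (metis homogenize_nth(1) zero_index zero_neq_one)

lemma vec_eq_option_iff:
  "x = y \<longleftrightarrow> x $ None = y $ None \<and> (\<forall>j. x $ Some j = y $ Some j)" for x y :: "'a ^ ('d :: finite option)"
  by (metis not_None_eq vec_eq_iff)

lemma homogenize_collinear_triple:
  assumes "collinear_triple x y z"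
  shows "\<exists>a b. homogenize z = a *s homogenize x + b *s homogenize y"
proof -
  obtain L where "complex_line L" "x \<in> L" "y \<in> L" "z \<in> L" "x \<noteq> y"
    using assms by (auto simp: collinear_triple_def card_eq_3_distinct)
  then obtain t where z: "z = x + t *s (y - x)"
    using complex_line_through by blast
  have "homogenize z = (1 - t) *s homogenize x + t *s homogenize y"
    by (simp add: z vec_eq_option_iff algebra_simps)
  then show ?thesis by blast
qed

text \<open>Differences of points of \<open>V\<close> span a space with zero \<open>None\<close>
  coordinate; a single homogenized point has 1 there and adds a dimension.\<close>

lemma complex_affine_dim_less:
  fixes V :: "(complex ^ 'd) set"
  assumes "V \<noteq> {}"
  shows "complex_affine_dim V + 1 \<le> vec.dim (homogenize ` V)"
proof -
  obtain a where "a \<in> V" using assms by blast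
  define W where "W = vec.span ((\<lambda>v. v - a) ` V)"
  have "V \<subseteq> (\<lambda>x. a + x) ` W"
  proof
    fix v assume "v \<in> V"
    then have "v - a \<in> W" by (auto simp: W_def intro: vec.span_base)
    then show "v \<in> (\<lambda>x. a + x) ` W" by (intro image_eqI[of _ _ "v - a"]) auto
  qed
  then have "complex_affine_dim V \<le> vec.dim W"
    unfolding complex_affine_dim_def W_def
    by (intro Least_le exI[of _ a] exI[of _ "vec.span ((\<lambda>v. v - a) ` V)"]) auto
  moreover have "vec.dim W + 1 \<le> vec.dim (homogenize ` V)"
  proof -
    define e :: "complex ^ 'd \<Rightarrow> complex ^ ('d option)"
      where "e v = (\<chi> i. case i of None \<Rightarrow> 0 | Some j \<Rightarrow> v $ j)" for v
    have e_nth: "e v $ None = 0" "e v $ Some j = v $ j" for v j by (simp_all add: e_def)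
    have lin: "Vector_Spaces.linear (*s) (*s) e"
      by unfold_locales (simp_all add: vec_eq_option_iff e_nth)
    have inj: "inj e" by (rule injI) (metis e_nth(2) vec_eq_iff)
    have eW: "e ` W = vec.span ((\<lambda>v. homogenize v - homogenize a) ` V)"
    proof -
      have "e (v - a) = homogenize v - homogenize a" for v
        by (simp add: vec_eq_option_iff e_nth)
      then show ?thesis
        unfolding W_def vec.linear_span_image[OF lin, symmetric] image_image by simp
    qed
    have "homogenize a \<notin> vec.span (e ` W)"
    proof -
      have "vec.span (e ` W) = e ` W" unfolding eW by (rule vec.span_span)
      then show ?thesis by (metis e_nth(1) homogenize_nth(1) imageE zero_neq_one)
    qed
    then have "vec.dim (insert (homogenize a) (e ` W)) = vec.dim W + 1"
      using vec.dim_image_eq[OF lin, of W] inj by (simp add: vec.dim_insert inj_on_subset)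
    moreover have "insert (homogenize a) (e ` W) \<subseteq> vec.span (homogenize ` V)"
    proof -
      have "(\<lambda>v. homogenize v - homogenize a) ` V \<subseteq> vec.span (homogenize ` V)"
        using \<open>a \<in> V\<close> by (intro image_subsetI vec.span_diff vec.span_base imageI)
      then have "e ` W \<subseteq> vec.span (homogenize ` V)"
        unfolding eW by (intro vec.span_minimal) auto
      then show ?thesis using \<open>a \<in> V\<close> by (auto intro: vec.span_base)
    qed
    ultimately show ?thesis
      using vec.dim_subset[of "insert (homogenize a) (e ` W)" "vec.span (homogenize ` V)"] by simp
  qed
  ultimately show ?thesis by linarith
qed

subsection \<open>The dimension bound\<close>

lemma finite_uniform_bound:
  fixes P :: "'a \<Rightarrow> real \<Rightarrow> bool"
  assumes "finite S" "\<And>s. s \<in> S \<Longrightarrow> \<exists>C. P s C" and mono: "\<And>s C D. P s C \<Longrightarrow> C \<le> D \<Longrightarrow> P s D"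
  obtains C where "C \<ge> 1" "\<And>s. s \<in> S \<Longrightarrow> P s C"
proof -
  obtain f where f: "\<And>s. s \<in> S \<Longrightarrow> P s (f s)" using assms(2) by metis
  \<comment> \<open>Inserting 1 yields \<open>C \<ge> 1\<close> and covers the empty set.\<close>
  have "f s \<le> Max (insert 1 (f ` S))" if "s \<in> S" for s
    using \<open>finite S\<close> that by simp
  then show thesis
    using \<open>finite S\<close> by (intro that[of "Max (insert 1 (f ` S))"] mono[OF f]) auto
qed

text \<open>The averaged triples bound the off-diagonal sum from below, the row sums bound it from
  above by \<open>card V\<close> minus the total weight, and the total weight is at least the
  dimension.\<close>

lemma SG_dim_bound_approx:
  fixes V :: "(complex ^ 'd) set"
  assumes SG: "SG_configuration \<delta> V" and "\<delta> > 0" "V \<noteq> {}" and \<eta>: "0 < \<eta>" "\<eta> < 1"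
  shows "real (vec.dim (homogenize ` V)) * (1 + (1 - \<eta>) / 4 * (\<delta> * (real (card V) - 1))) \<le> card V"
proof -
  have finV: "finite V" using SG by (simp add: SG_configuration_def)
  define S where "S = {(x, y, z). collinear_triple x y z} \<inter> V \<times> V \<times> V"
  define P :: "(complex ^ 'd) \<times> (complex ^ 'd) \<times> (complex ^ 'd) \<Rightarrow> real \<Rightarrow> bool" where
    "P = (\<lambda>(x, y, z) C. \<exists>a b. homogenize z = a *s homogenize x + b *s homogenize y \<and> norm a \<le> C)"
  \<comment> \<open>Linear relations survive every \<open>T\<close>, so \<open>C\<close> can be
    fixed before \<open>p\<close> and \<open>T\<close> are chosen.\<close>
  obtain C where "C \<ge> 1" and C: "\<And>s. s \<in> S \<Longrightarrow> P s C"
  proof (rule finite_uniform_bound[of S P])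
    show "finite S" using finV by (simp add: S_def)
    show "\<exists>C. P s C" if "s \<in> S" for s
      using that homogenize_collinear_triple by (fastforce simp: S_def P_def)
    show "P s D" if "P s C" "C \<le> D" for s C D
      using that unfolding P_def by (cases s) (fastforce intro: order.trans)
  qed blast
  \<comment> \<open>With \<open>p = 1 / m\<close> this power is
    \<open>(1 - \<eta>) powr (1 / p)\<close>.\<close>
  obtain m where m: "(1 - \<eta>) ^ m < 1 / (2 * C)"
    using real_arch_pow_inv[of "1 / (2 * C)" "1 - \<eta>"] \<open>C \<ge> 1\<close> \<eta> by auto
  have "m > 0" using m \<open>C \<ge> 1\<close> by (cases "m = 0") (auto simp: field_simps)
  define p where "p = 1 / real m"
  have "p > 0" using \<open>m > 0\<close> by (simp add: p_def)
  have small: "(1 - \<eta>) powr (1 / p) * C \<le> 1 / 2"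
    using m \<eta> \<open>C \<ge> 1\<close> by (simp add: p_def powr_realpow field_simps)
  have image: "finite (homogenize ` V)" "0 \<notin> homogenize ` V"
    using finV homogenize_nonzero by (simp, metis imageE)
  obtain T :: "complex ^ 'd option ^ 'd option" and l where T: "invertible T" and "l > 0"
    and dim: "real (vec.dim (homogenize ` V)) \<le> (\<Sum>x\<in>homogenize ` V. norm (T *v x) powr p / l)"
    and row: "\<And>y. y \<in> homogenize ` V \<Longrightarrow>
      (\<Sum>x\<in>homogenize ` V. norm (T *v x) powr p / l * angle_cos2 (T *v x) (T *v y)) \<le> 1"
    by (rule isotropic_weights[OF image \<open>p > 0\<close>]) blast
  define h where "h v = T *v homogenize v" for v
  define c where "c v = norm (h v) powr p / l" for v
  define g where "g v w = angle_cos2 (h v) (h w)" for v w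
  have inj: "inj h"
    using inj_matrix_vector_mult[OF T] inj_homogenize unfolding h_def inj_def by metis
  have nz: "h v \<noteq> 0" for v
    unfolding h_def using inj_matrix_vector_mult[OF T] homogenize_nonzero
    by (metis injD matrix_vector_mult_0_right)
  have inj_on: "inj_on homogenize V" using inj_homogenize by (rule inj_on_subset) simp
  have dim: "real (vec.dim (homogenize ` V)) \<le> (\<Sum>v\<in>V. c v)"
    using dim by (simp add: sum.reindex[OF inj_on] c_def h_def)
  have row: "(\<Sum>v\<in>V. c v * g v w) \<le> 1" if "w \<in> V" for w
    using row[of "homogenize w"] that by (simp add: sum.reindex[OF inj_on] c_def h_def g_def)
  have g_sym: "g v w = g w v" for v w
    unfolding g_def by (rule angle_cos2_commute)
  have row: "(\<Sum>v\<in>V - {w}. c v * g w v) \<le> 1 - c w" if "w \<in> V" for w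
  proof -
    have "(\<Sum>v\<in>V. c v * g v w) = c w * g w w + (\<Sum>v\<in>V - {w}. c v * g v w)"
      by (rule sum.remove[OF finV that])
    moreover have "g w w = 1" unfolding g_def by (rule angle_cos2_self[OF nz])
    moreover have "(\<Sum>v\<in>V - {w}. c v * g w v) = (\<Sum>v\<in>V - {w}. c v * g v w)"
      by (intro sum.cong refl arg_cong[where f = "(*) _"] g_sym)
    ultimately show ?thesis using row[OF that] by simp
  qed
  define d where "d = \<delta> * (real (card V) - 1)"
  have "(1 - \<eta>) / 2 / 2 * d * (\<Sum>v\<in>V. c v) \<le> (\<Sum>v\<in>V. \<Sum>w\<in>V - {v}. c w * g v w)"
  proof (rule averaging_over_triples[where R = collinear_triple])
    show "collinear_triple x y z \<Longrightarrow> collinear_triple y x z"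
      "collinear_triple x y z \<Longrightarrow> collinear_triple x z y" for x y z :: "complex ^ 'd"
      by (simp_all add: collinear_triple_def insert_commute)
    show "collinear_triple x y z \<Longrightarrow> y \<noteq> z" for x y z :: "complex ^ 'd"
      by (simp add: collinear_triple_def card_eq_3_distinct)
    show "d \<le> real (card {y \<in> V. \<exists>z\<in>V. collinear_triple x y z})" if "x \<in> V" for x
    proof -
      have "d \<le> real (card {w \<in> V - {x}. \<exists>L. special_line V L \<and> x \<in> L \<and> w \<in> L})"
        using SG that by (auto simp: SG_configuration_def d_def)
      moreover have "{w \<in> V - {x}. \<exists>L. special_line V L \<and> x \<in> L \<and> w \<in> L} \<subseteq>
          {y \<in> V. \<exists>z\<in>V. collinear_triple x y z}"
      proof
        fix w assume "w \<in> {w \<in> V - {x}. \<exists>L. special_line V L \<and> x \<in> L \<and> w \<in> L}"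
        then obtain L where w: "w \<in> V" "w \<noteq> x" "special_line V L" "x \<in> L" "w \<in> L" by blast
        \<comment> \<open>A special line has a third point in \<open>V\<close>.\<close>
        have "\<not> L \<inter> V \<subseteq> {x, w}"
        proof
          assume "L \<inter> V \<subseteq> {x, w}"
          then have "card (L \<inter> V) \<le> card {x, w}" by (rule card_mono[rotated]) simp
          then show False using w(2,3) by (simp add: special_line_def)
        qed
        then obtain z where "z \<in> L" "z \<in> V" "z \<noteq> x" "z \<noteq> w" by blast
        then have "collinear_triple x w z"
          using w by (auto simp: collinear_triple_def card_eq_3_distinct special_line_def)
        then show "w \<in> {y \<in> V. \<exists>z\<in>V. collinear_triple x y z}" using \<open>w \<in> V\<close> \<open>z \<in> V\<close> by blast
      qed
      then have "card {w \<in> V - {x}. \<exists>L. special_line V L \<and> x \<in> L \<and> w \<in> L} \<le>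
          card {y \<in> V. \<exists>z\<in>V. collinear_triple x y z}"
        using finV by (intro card_mono) auto
      ultimately show ?thesis by linarith
    qed
    show "(1 - \<eta>) / 2 * (c x + c y + c z) \<le> (c x + c y) * g x y + (c y + c z) * g y z + (c x + c z) * g x z"
      if V: "x \<in> V" "y \<in> V" "z \<in> V" and col: "collinear_triple x y z" for x y z
      unfolding c_def g_def
    proof (rule weighted_triple[OF nz nz nz \<open>l > 0\<close> \<open>p > 0\<close> \<eta> small])
      fix x' y' z' assume "{x', y', z'} = {h x, h y, h z}"
      then have eq: "{x', y', z'} = h ` {x, y, z}" by simp
      \<comment> \<open>Pulling the vectors back along \<open>h\<close> recovers points of
        \<open>V\<close>, whose relation is already bounded by \<open>C\<close>.\<close>
      have perm: "{inv h x', inv h y', inv h z'} = {x, y, z}"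
        using arg_cong[OF eq, of "image (inv h)"] by (simp add: inv_f_f[OF inj])
      have "{x', y', z'} \<subseteq> range h" unfolding eq by blast
      then have x': "h (inv h x') = x'" "h (inv h y') = y'" "h (inv h z') = z'"
        by (simp_all add: f_inv_into_f)
      have "collinear_triple (inv h x') (inv h y') (inv h z')"
        using col unfolding collinear_triple_def perm .
      moreover have "{inv h x', inv h y', inv h z'} \<subseteq> V" unfolding perm using V by simp
      ultimately have "P (inv h x', inv h y', inv h z') C" by (intro C) (simp add: S_def)
      then obtain a b where ab: "norm a \<le> C"
        "homogenize (inv h z') = a *s homogenize (inv h x') + b *s homogenize (inv h y')"
        by (auto simp: P_def)
      have "h (inv h z') = a *s h (inv h x') + b *s h (inv h y')"
        unfolding h_def[of "inv h _"] ab(2) by (simp add: matrix_vector_right_distrib vector_scalar_commute)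
      then show "\<exists>a b. z' = a *s x' + b *s y' \<and> norm a \<le> C"
        unfolding x' using ab(1) by blast
    qed
    show "g x y = g y x" for x y by (rule g_sym)
    show "g x y \<ge> 0" for x y by (simp add: g_def angle_cos2_nonneg)
    show "c x \<ge> 0" for x using \<open>l > 0\<close> by (simp add: c_def)
    show "collinear_triple x z w" if "collinear_triple x y z" "collinear_triple x y w" "z \<noteq> w" for x y z w :: "complex ^ 'd"
      using that by (rule collinear_triple_trans)
  qed (use finV \<eta> in auto)
  also have "\<dots> \<le> (\<Sum>v\<in>V. 1 - c v)" by (intro sum_mono row)
  also have "\<dots> = card V - (\<Sum>v\<in>V. c v)" by (simp add: sum_subtractf)
  finally have "(\<Sum>v\<in>V. c v) * (1 + (1 - \<eta>) / 4 * d) \<le> card V" by (simp add: algebra_simps)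
  moreover have "card V \<ge> 1" using finV \<open>V \<noteq> {}\<close> by (simp add: Suc_le_eq card_gt_0_iff)
  then have "1 + (1 - \<eta>) / 4 * d \<ge> 0"
    using \<open>\<delta> > 0\<close> \<eta> by (simp add: d_def)
  then have "real (vec.dim (homogenize ` V)) * (1 + (1 - \<eta>) / 4 * d) \<le> (\<Sum>v\<in>V. c v) * (1 + (1 - \<eta>) / 4 * d)"
    by (rule mult_right_mono[OF dim])
  ultimately show ?thesis by (simp add: d_def)
qed

text \<open>The approximate bound no longer mentions \<open>T\<close>, \<open>p\<close> or
  \<open>C\<close>, so \<open>\<eta>\<close> may tend to 0 from the right.\<close>

lemma SG_dim_bound:
  fixes V :: "(complex ^ 'd) set"
  assumes "SG_configuration \<delta> V" "\<delta> > 0" "V \<noteq> {}"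
  shows "real (vec.dim (homogenize ` V)) * (4 + \<delta> * (real (card V) - 1)) \<le> 4 * card V"
proof -
  let ?D = "real (vec.dim (homogenize ` V))" and ?d = "\<delta> * (real (card V) - 1)"
  have "((\<lambda>\<eta>. ?D * (1 + (1 - \<eta>) / 4 * ?d)) \<longlongrightarrow> ?D * (1 + (1 - 0) / 4 * ?d)) (at_right 0)"
    by (intro tendsto_intros) simp
  moreover have "eventually (\<lambda>\<eta>. ?D * (1 + (1 - \<eta>) / 4 * ?d) \<le> card V) (at_right 0)"
    using eventually_at_right_real[of 0 "1 :: real", OF zero_less_one]
    by eventually_elim (use SG_dim_bound_approx[OF assms] in auto)
  ultimately have "?D * (1 + (1 - 0) / 4 * ?d) \<le> card V"
    by (rule tendsto_upperbound) simp
  then show ?thesis by (simp add: algebra_simps)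
qed

theorem theorem1p9:
  fixes V :: "(complex ^ 'd) set" and \<delta> :: real
  assumes "\<delta> > 0"
    and "SG_configuration \<delta> V"
  shows "real (complex_affine_dim V) \<le> 12 / \<delta> \<and>
         (\<delta> = 1 \<longrightarrow> complex_affine_dim V \<le> 2)"
proof (cases "V = {}")
  case True
  then have "complex_affine_dim V \<le> 0"
    unfolding complex_affine_dim_def by (intro Least_le exI[of _ "0 :: complex ^ 'd"] exI[of _ "{0}"]) auto
  then show ?thesis using \<open>\<delta> > 0\<close> by simp
next
  case False
  define D where "D = vec.dim (homogenize ` V)"
  define n where "n = card V"
  have less: "complex_affine_dim V + 1 \<le> D"
    unfolding D_def using False by (rule complex_affine_dim_less)
  have bound: "real D * (4 + \<delta> * (real n - 1)) \<le> 4 * n"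
    unfolding D_def n_def by (rule SG_dim_bound[OF assms(2,1) False])
  have "n \<ge> 1"
    using assms(2) False by (simp add: n_def SG_configuration_def Suc_le_eq card_gt_0_iff)
  show ?thesis
  proof (cases "n = 1")
    \<comment> \<open>For one point \<open>bound\<close> reads \<open>4 * D \<le> 4\<close>; the
      case is separate because the other one divides by \<open>n - 1\<close>.\<close>
    case True
    with bound less have "complex_affine_dim V = 0" by simp
    then show ?thesis using \<open>\<delta> > 0\<close> by simp
  next
    case False
    then have "n \<ge> 2" using \<open>n \<ge> 1\<close> by simp
    \<comment> \<open>The term \<open>4 * D\<close> is dropped.\<close>
    have "\<delta> * D * (real n - 1) \<le> 4 * n"
      using bound by (simp add: algebra_simps)
    also have "\<dots> \<le> 12 * (real n - 1)" using \<open>n \<ge> 2\<close> by simp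
    finally have "\<delta> * D \<le> 12"
      by (rule mult_right_le_imp_le) (use \<open>n \<ge> 2\<close> in simp)
    then have "real D \<le> 12 / \<delta>" using \<open>\<delta> > 0\<close> by (simp add: field_simps)
    then have "real (complex_affine_dim V) \<le> 12 / \<delta>" using less by linarith
    \<comment> \<open>Now \<open>D * (n + 3) \<le> 4 * n\<close> forces \<open>D < 4\<close>; the
      term \<open>4 * D\<close> is essential here.\<close>
    moreover have "complex_affine_dim V \<le> 2" if "\<delta> = 1"
    proof (rule ccontr)
      assume "\<not> ?thesis"
      then have "real D \<ge> 4" using less by simp
      then have "4 * (real n + 3) \<le> real D * (real n + 3)" by (intro mult_right_mono) auto
      then show False using bound that by (simp add: algebra_simps)
    qed
    ultimately show ?thesis by blast
  qed
qed

end
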